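(* Let $k$ be a field equipped with the identity conjugation. For each positive integer $i$ choose $D_i\in k$, and recursively define the $k$-algebras $k_i$, $i\ge 0$, by $k_0=k$ and $k_i=k_{i-1}\times_{D_i}k_{i-1}$ for $i\ge 1$. Then, for all $i\ge 1$, if an $a\in k_i$ satisfies $n(a)=1$, then there is a nonzero $b\in k_i$ satisfying $\overline{b}a=b$.
   Context: Let $k$ be a field. A $k$-algebra $K$ (not assumed commutative, associative or distributive) is a left $k$-vector space equipped with a multiplication and a multiplicative identity $1$ such that: $k$ is a subset of the center of $K$, and the additive and multiplicative structure on $k$ is the restriction of that on $K$; and $a(bc)=(ab)c$ for $a,b,c\in K$ whenever at least one of $a,b,c$ belongs to $k$. A conjugation on $K$ is a self-inverse $k$-linear map $\overline{\phantom{a}}:K\to K$ restricting to the identity on $k$. The norm is $n(a)=\overline{a}a$. Given a $k$-algebra $K$ with conjugation and $D\in k$, the Cayley-Dickson double $K\times_D K$ is the $k$-vector space $K\times K$ with conjugation $\overline{(a,b)}=(\overline{a},-b)$ and multiplication $(a,b)(c,d)=(ac+Dd\overline{b},\ \overline{a}d+cb)$ for $a,b,c,d\in K$. It is a $k$-algebra with identity $(1,0)$; $K$ (and hence $k$) is regarded as contained in it via $a\mapsto(a,0)$. *)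

theory Defs
  imports "HOL-Algebra.Module"
begin

record ('k, 'v) conj_algebra = "('k, 'v) module" +
  conjugate :: "'v \<Rightarrow> 'v"

text \<open>
  Neither commutativity, associativity nor distributivity of the multiplication is assumed, so
  \<^locale>\<open>algebra\<close> does not apply. The field \<^term>\<open>R\<close> is regarded as a subset of
  the algebra via \<open>r \<mapsto> r \<odot> \<one>\<close>.
\<close>

definition ground :: "('k, 'r) ring_scheme \<Rightarrow> ('k, 'v, 'm) module_scheme \<Rightarrow> 'v set" where
  "ground R K = (\<lambda>r. r \<odot>\<^bsub>K\<^esub> \<one>\<^bsub>K\<^esub>) ` carrier R"

locale conj_algebra = field R + module R K for R (structure) and K (structure) +
  assumes K_one_closed: "\<one>\<^bsub>K\<^esub> \<in> carrier K"
    and K_mult_closed: "\<lbrakk>a \<in> carrier K; b \<in> carrier K\<rbrakk> \<Longrightarrow> a \<otimes>\<^bsub>K\<^esub> b \<in> carrier K"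
    and K_l_one: "a \<in> carrier K \<Longrightarrow> \<one>\<^bsub>K\<^esub> \<otimes>\<^bsub>K\<^esub> a = a"
    and K_r_one: "a \<in> carrier K \<Longrightarrow> a \<otimes>\<^bsub>K\<^esub> \<one>\<^bsub>K\<^esub> = a"
    and ground_inj: "inj_on (\<lambda>r. r \<odot>\<^bsub>K\<^esub> \<one>\<^bsub>K\<^esub>) (carrier R)"
    and ground_mult: "\<lbrakk>r \<in> carrier R; a \<in> carrier K\<rbrakk> \<Longrightarrow> (r \<odot>\<^bsub>K\<^esub> \<one>\<^bsub>K\<^esub>) \<otimes>\<^bsub>K\<^esub> a = r \<odot>\<^bsub>K\<^esub> a"
    and ground_central: "\<lbrakk>x \<in> ground R K; a \<in> carrier K\<rbrakk> \<Longrightarrow> x \<otimes>\<^bsub>K\<^esub> a = a \<otimes>\<^bsub>K\<^esub> x"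
    and ground_assoc:
      "\<lbrakk>a \<in> carrier K; b \<in> carrier K; c \<in> carrier K;
        a \<in> ground R K \<or> b \<in> ground R K \<or> c \<in> ground R K\<rbrakk>
       \<Longrightarrow> a \<otimes>\<^bsub>K\<^esub> (b \<otimes>\<^bsub>K\<^esub> c) = (a \<otimes>\<^bsub>K\<^esub> b) \<otimes>\<^bsub>K\<^esub> c"
    and conj_closed: "a \<in> carrier K \<Longrightarrow> conjugate K a \<in> carrier K"
    and conj_conj: "a \<in> carrier K \<Longrightarrow> conjugate K (conjugate K a) = a"
    and conj_add: "\<lbrakk>a \<in> carrier K; b \<in> carrier K\<rbrakk>
       \<Longrightarrow> conjugate K (a \<oplus>\<^bsub>K\<^esub> b) = conjugate K a \<oplus>\<^bsub>K\<^esub> conjugate K b"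
    and conj_smult: "\<lbrakk>r \<in> carrier R; a \<in> carrier K\<rbrakk>
       \<Longrightarrow> conjugate K (r \<odot>\<^bsub>K\<^esub> a) = r \<odot>\<^bsub>K\<^esub> conjugate K a"
    and conj_ground: "x \<in> ground R K \<Longrightarrow> conjugate K x = x"

definition cd_norm :: "('k, 'v) conj_algebra \<Rightarrow> 'v \<Rightarrow> 'v" where
  "cd_norm K a = conjugate K a \<otimes>\<^bsub>K\<^esub> a"

text \<open>
  The algebras of the tower must all live in one type. Elements of the base field are
  represented by \<open>Scalar\<close>, and \<open>K \<times> K\<close> by the pairs \<open>Pr a b\<close>.
\<close>

datatype 'k cd = Scalar (scalar: 'k) | Pr (cd_fst: "'k cd") (cd_snd: "'k cd")

definition cd_base :: "('k, 'r) ring_scheme \<Rightarrow> ('k, 'k cd) conj_algebra" where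
  "cd_base R =
    \<lparr> carrier = Scalar ` carrier R,
      mult = (\<lambda>x y. Scalar (scalar x \<otimes>\<^bsub>R\<^esub> scalar y)),
      one = Scalar \<one>\<^bsub>R\<^esub>,
      zero = Scalar \<zero>\<^bsub>R\<^esub>,
      add = (\<lambda>x y. Scalar (scalar x \<oplus>\<^bsub>R\<^esub> scalar y)),
      smult = (\<lambda>r x. Scalar (r \<otimes>\<^bsub>R\<^esub> scalar x)),
      conjugate = (\<lambda>x. x) \<rparr>"

definition cd_double :: "'k \<Rightarrow> ('k, 'k cd) conj_algebra \<Rightarrow> ('k, 'k cd) conj_algebra" where
  "cd_double D K =
    \<lparr> carrier = {Pr a b | a b. a \<in> carrier K \<and> b \<in> carrier K},
      mult = (\<lambda>x y. case (x, y) of (Pr a b, Pr c d) \<Rightarrow>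
        Pr (a \<otimes>\<^bsub>K\<^esub> c \<oplus>\<^bsub>K\<^esub> D \<odot>\<^bsub>K\<^esub> (d \<otimes>\<^bsub>K\<^esub> conjugate K b))
           (conjugate K a \<otimes>\<^bsub>K\<^esub> d \<oplus>\<^bsub>K\<^esub> c \<otimes>\<^bsub>K\<^esub> b)),
      one = Pr \<one>\<^bsub>K\<^esub> \<zero>\<^bsub>K\<^esub>,
      zero = Pr \<zero>\<^bsub>K\<^esub> \<zero>\<^bsub>K\<^esub>,
      add = (\<lambda>x y. case (x, y) of (Pr a b, Pr c d) \<Rightarrow> Pr (a \<oplus>\<^bsub>K\<^esub> c) (b \<oplus>\<^bsub>K\<^esub> d)),
      smult = (\<lambda>r x. case x of Pr a b \<Rightarrow> Pr (r \<odot>\<^bsub>K\<^esub> a) (r \<odot>\<^bsub>K\<^esub> b)),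
      conjugate = (\<lambda>x. case x of Pr a b \<Rightarrow> Pr (conjugate K a) (\<ominus>\<^bsub>K\<^esub> b)) \<rparr>"

primrec cd_tower :: "('k, 'r) ring_scheme \<Rightarrow> (nat \<Rightarrow> 'k) \<Rightarrow> nat \<Rightarrow> ('k, 'k cd) conj_algebra" where
  "cd_tower R D 0 = cd_base R"
| "cd_tower R D (Suc i) = cd_double (D (Suc i)) (cd_tower R D i)"

lemma conj_algebra_cd_base:
  assumes "field R"
  shows "conj_algebra R (cd_base R)"
proof -
  interpret field R by fact
  have "module R (cd_base R)"
  proof (rule moduleI)
    show "abelian_group (cd_base R)"
      by (rule abelian_groupI) (auto simp: cd_base_def a_assoc a_comm a_lcomm intro: l_neg)
  qed (auto simp: cd_base_def l_distr r_distr m_assoc is_cring)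
  then interpret module R "cd_base R" .
  show ?thesis
    by unfold_locales
      (auto simp: cd_base_def ground_def m_assoc m_comm m_lcomm inj_on_def)
qed

context conj_algebra
begin

lemma smult_mult:
  assumes "r \<in> carrier R" "a \<in> carrier K" "b \<in> carrier K"
  shows "(r \<odot>\<^bsub>K\<^esub> a) \<otimes>\<^bsub>K\<^esub> b = r \<odot>\<^bsub>K\<^esub> (a \<otimes>\<^bsub>K\<^esub> b)"
    and "a \<otimes>\<^bsub>K\<^esub> (r \<odot>\<^bsub>K\<^esub> b) = r \<odot>\<^bsub>K\<^esub> (a \<otimes>\<^bsub>K\<^esub> b)"
proof -
  let ?e = "r \<odot>\<^bsub>K\<^esub> \<one>\<^bsub>K\<^esub>"
  have g: "?e \<in> ground R K" and e: "?e \<in> carrier K"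
    using assms by (auto simp: ground_def K_one_closed)
  have ab: "a \<otimes>\<^bsub>K\<^esub> b \<in> carrier K" using assms by (simp add: K_mult_closed)
  show 1: "(r \<odot>\<^bsub>K\<^esub> a) \<otimes>\<^bsub>K\<^esub> b = r \<odot>\<^bsub>K\<^esub> (a \<otimes>\<^bsub>K\<^esub> b)"
    using ground_assoc[OF e assms(2,3)] g by (simp add: ground_mult assms ab)
  have "a \<otimes>\<^bsub>K\<^esub> (?e \<otimes>\<^bsub>K\<^esub> b) = (a \<otimes>\<^bsub>K\<^esub> ?e) \<otimes>\<^bsub>K\<^esub> b"
    using ground_assoc[OF assms(2) e assms(3)] g by simp
  also have "a \<otimes>\<^bsub>K\<^esub> ?e = r \<odot>\<^bsub>K\<^esub> a"
    using ground_central[OF g assms(2)] by (simp add: ground_mult assms)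
  finally show "a \<otimes>\<^bsub>K\<^esub> (r \<odot>\<^bsub>K\<^esub> b) = r \<odot>\<^bsub>K\<^esub> (a \<otimes>\<^bsub>K\<^esub> b)"
    by (simp add: ground_mult assms 1)
qed

lemma mult_zero:
  assumes "a \<in> carrier K"
  shows "\<zero>\<^bsub>K\<^esub> \<otimes>\<^bsub>K\<^esub> a = \<zero>\<^bsub>K\<^esub>" "a \<otimes>\<^bsub>K\<^esub> \<zero>\<^bsub>K\<^esub> = \<zero>\<^bsub>K\<^esub>"
  using smult_mult[of \<zero> a a] assms by (simp_all add: K_mult_closed)

lemma conj_one: "conjugate K \<one>\<^bsub>K\<^esub> = \<one>\<^bsub>K\<^esub>"
proof (rule conj_ground)
  show "\<one>\<^bsub>K\<^esub> \<in> ground R K"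
    unfolding ground_def by (rule image_eqI[of _ _ \<one>]) (simp_all add: K_one_closed)
qed

lemma conj_zero: "conjugate K \<zero>\<^bsub>K\<^esub> = \<zero>\<^bsub>K\<^esub>"
  using conj_smult[of \<zero> "\<zero>\<^bsub>K\<^esub>"] by (simp add: conj_closed)

lemmas conj_alg_simps = K_one_closed K_mult_closed K_l_one K_r_one conj_closed conj_conj
  conj_add conj_smult conj_one conj_zero smult_mult mult_zero

end

lemma conj_algebra_cd_double:
  fixes R (structure) and K :: "('k, 'k cd) conj_algebra"
  assumes "conj_algebra R K" and D: "D \<in> carrier R"
  shows "conj_algebra R (cd_double D K)"
proof -
  interpret conj_algebra R K by fact
  let ?L = "cd_double D K"
  have "module R ?L"
  proof (rule moduleI)
    show "abelian_group ?L"
    proof (rule abelian_groupI)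
      fix x assume "x \<in> carrier ?L"
      then obtain a b where x: "x = Pr a b" "a \<in> carrier K" "b \<in> carrier K"
        by (auto simp: cd_double_def)
      then show "\<exists>y\<in>carrier ?L. y \<oplus>\<^bsub>?L\<^esub> x = \<zero>\<^bsub>?L\<^esub>"
        by (intro bexI[of _ "Pr (\<ominus>\<^bsub>K\<^esub> a) (\<ominus>\<^bsub>K\<^esub> b)"]) (auto simp: cd_double_def M.l_neg)
    qed (auto simp: cd_double_def M.a_assoc M.a_comm M.a_lcomm)
  qed (auto simp: cd_double_def smult_l_distr smult_r_distr smult_assoc1 is_cring)
  then interpret L: module R ?L .
  have scalar: "r \<odot>\<^bsub>?L\<^esub> \<one>\<^bsub>?L\<^esub> = Pr (r \<odot>\<^bsub>K\<^esub> \<one>\<^bsub>K\<^esub>) \<zero>\<^bsub>K\<^esub>" if "r \<in> carrier R" for r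
    using that by (simp add: cd_double_def)
  have mult: "Pr a b \<otimes>\<^bsub>?L\<^esub> Pr c d =
      Pr (a \<otimes>\<^bsub>K\<^esub> c \<oplus>\<^bsub>K\<^esub> D \<odot>\<^bsub>K\<^esub> (d \<otimes>\<^bsub>K\<^esub> conjugate K b))
         (conjugate K a \<otimes>\<^bsub>K\<^esub> d \<oplus>\<^bsub>K\<^esub> c \<otimes>\<^bsub>K\<^esub> b)" for a b c d
    by (simp add: cd_double_def)
  have carrL: "x \<in> carrier ?L \<longleftrightarrow> (\<exists>a b. x = Pr a b \<and> a \<in> carrier K \<and> b \<in> carrier K)" for x
    by (simp add: cd_double_def)
  have smultL: "r \<odot>\<^bsub>?L\<^esub> Pr a b = Pr (r \<odot>\<^bsub>K\<^esub> a) (r \<odot>\<^bsub>K\<^esub> b)" for r a b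
    by (simp add: cd_double_def)
  have swap: "r \<odot>\<^bsub>K\<^esub> (D \<odot>\<^bsub>K\<^esub> x) = D \<odot>\<^bsub>K\<^esub> (r \<odot>\<^bsub>K\<^esub> x)" if "r \<in> carrier R" "x \<in> carrier K" for r x
    using that D by (simp flip: smult_assoc1 add: m_comm)
  have closed: "x \<otimes>\<^bsub>?L\<^esub> y \<in> carrier ?L" if "x \<in> carrier ?L" "y \<in> carrier ?L" for x y
    using that D by (auto simp: carrL mult conj_alg_simps)
  have l: "(r \<odot>\<^bsub>?L\<^esub> \<one>\<^bsub>?L\<^esub>) \<otimes>\<^bsub>?L\<^esub> x = r \<odot>\<^bsub>?L\<^esub> x"
    if "r \<in> carrier R" "x \<in> carrier ?L" for r x
    using that D by (auto simp: scalar carrL mult smultL conj_alg_simps)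
  have r: "x \<otimes>\<^bsub>?L\<^esub> (r \<odot>\<^bsub>?L\<^esub> \<one>\<^bsub>?L\<^esub>) = r \<odot>\<^bsub>?L\<^esub> x"
    if "r \<in> carrier R" "x \<in> carrier ?L" for r x
    using that D by (auto simp: scalar carrL mult smultL conj_alg_simps)
  have sm: "(r \<odot>\<^bsub>?L\<^esub> x) \<otimes>\<^bsub>?L\<^esub> y = r \<odot>\<^bsub>?L\<^esub> (x \<otimes>\<^bsub>?L\<^esub> y)"
    "x \<otimes>\<^bsub>?L\<^esub> (r \<odot>\<^bsub>?L\<^esub> y) = r \<odot>\<^bsub>?L\<^esub> (x \<otimes>\<^bsub>?L\<^esub> y)"
    if "r \<in> carrier R" "x \<in> carrier ?L" "y \<in> carrier ?L" for r x y
    using that D by (auto simp: carrL mult smultL conj_alg_simps smult_r_distr swap)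
  have one: "\<one>\<^bsub>?L\<^esub> = \<one> \<odot>\<^bsub>?L\<^esub> \<one>\<^bsub>?L\<^esub>" and oneL: "\<one>\<^bsub>?L\<^esub> \<in> carrier ?L"
    by (auto simp: cd_double_def conj_alg_simps)
  show ?thesis
  proof unfold_locales
    show "\<one>\<^bsub>?L\<^esub> \<in> carrier ?L" by (fact oneL)
    show "a \<otimes>\<^bsub>?L\<^esub> b \<in> carrier ?L" if "a \<in> carrier ?L" "b \<in> carrier ?L" for a b
      using that by (rule closed)
    show "\<one>\<^bsub>?L\<^esub> \<otimes>\<^bsub>?L\<^esub> a = a" "a \<otimes>\<^bsub>?L\<^esub> \<one>\<^bsub>?L\<^esub> = a" if "a \<in> carrier ?L" for a
      using l[of \<one> a] r[of \<one> a] that oneL by simp_all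
    show "inj_on (\<lambda>r. r \<odot>\<^bsub>?L\<^esub> \<one>\<^bsub>?L\<^esub>) (carrier R)"
      using ground_inj by (auto simp: inj_on_def scalar)
    show "(r \<odot>\<^bsub>?L\<^esub> \<one>\<^bsub>?L\<^esub>) \<otimes>\<^bsub>?L\<^esub> a = r \<odot>\<^bsub>?L\<^esub> a"
      if "r \<in> carrier R" "a \<in> carrier ?L" for r a
      using that by (rule l)
    show "x \<otimes>\<^bsub>?L\<^esub> a = a \<otimes>\<^bsub>?L\<^esub> x" if "x \<in> ground R ?L" "a \<in> carrier ?L" for x a
      using that by (auto simp: ground_def l r)
    show "a \<otimes>\<^bsub>?L\<^esub> (b \<otimes>\<^bsub>?L\<^esub> c) = (a \<otimes>\<^bsub>?L\<^esub> b) \<otimes>\<^bsub>?L\<^esub> c"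
      if "a \<in> carrier ?L" "b \<in> carrier ?L" "c \<in> carrier ?L"
        "a \<in> ground R ?L \<or> b \<in> ground R ?L \<or> c \<in> ground R ?L" for a b c
      using that by (auto simp: ground_def l r sm closed)
    show "conjugate ?L x = x" if "x \<in> ground R ?L" for x
      using that by (auto simp: ground_def cd_double_def conj_alg_simps)
  qed (auto simp: cd_double_def conj_alg_simps M.minus_add smult_r_minus)
qed

lemma conj_algebra_cd_tower:
  assumes "field R" and "\<And>i. 1 \<le> i \<Longrightarrow> D i \<in> carrier R"
  shows "conj_algebra R (cd_tower R D i)"
  using assms by (induction i) (simp_all add: conj_algebra_cd_base conj_algebra_cd_double)

end

(* The tower is distributive, since doubling preserves distributivity. Hence b = 1 + a satisfies
   conj(b) a = a + n(a) = b, which settles the case a \<noteq> -1. For a = -1 any nonzero b with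
   conj(b) = -b will do, for instance the new generator (0, 1) of the last doubling. *)
theory Submission
  imports Defs
begin

text \<open>Distributivity is not among the axioms of \<open>conj_algebra\<close>, so it becomes an
  invariant of its own, carried up the tower by induction.\<close>

locale distributive_conj_algebra = conj_algebra +
  assumes K_l_distr: "\<lbrakk>a \<in> carrier K; b \<in> carrier K; c \<in> carrier K\<rbrakk>
      \<Longrightarrow> (a \<oplus>\<^bsub>K\<^esub> b) \<otimes>\<^bsub>K\<^esub> c = a \<otimes>\<^bsub>K\<^esub> c \<oplus>\<^bsub>K\<^esub> b \<otimes>\<^bsub>K\<^esub> c"
    and K_r_distr: "\<lbrakk>a \<in> carrier K; b \<in> carrier K; c \<in> carrier K\<rbrakk>
      \<Longrightarrow> c \<otimes>\<^bsub>K\<^esub> (a \<oplus>\<^bsub>K\<^esub> b) = c \<otimes>\<^bsub>K\<^esub> a \<oplus>\<^bsub>K\<^esub> c \<otimes>\<^bsub>K\<^esub> b"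

lemma distributive_cd_base:
  assumes "field R"
  shows "distributive_conj_algebra R (cd_base R)"
proof -
  interpret field R by fact
  interpret C: conj_algebra R "cd_base R"
    by (rule conj_algebra_cd_base) fact
  show ?thesis
    by unfold_locales (auto simp: cd_base_def l_distr r_distr)
qed

text \<open>Conjugation and scaling by \<open>D\<close> are additive on \<open>K\<close>, so each of
  the four terms in the product of two pairs is additive in either factor.\<close>

lemma distributive_cd_double:
  fixes R (structure) and K :: "('k, 'k cd) conj_algebra"
  assumes "distributive_conj_algebra R K" and D: "D \<in> carrier R"
  shows "distributive_conj_algebra R (cd_double D K)"
proof -
  interpret distributive_conj_algebra R K by fact
  interpret L: conj_algebra R "cd_double D K"
    by (rule conj_algebra_cd_double) (fact conj_algebra_axioms D)+
  show ?thesis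
    using D by unfold_locales
      (auto simp: cd_double_def conj_alg_simps K_l_distr K_r_distr smult_r_distr M.a_ac)
qed

lemma distributive_cd_tower:
  assumes "field R" and "\<And>i. 1 \<le> i \<Longrightarrow> D i \<in> carrier R"
  shows "distributive_conj_algebra R (cd_tower R D i)"
  using assms by (induction i) (simp_all add: distributive_cd_base distributive_cd_double)

context conj_algebra
begin

text \<open>Otherwise the distinct scalars 1 and 0 of the field would have the same image in
  \<open>K\<close>, against \<open>ground_inj\<close>.\<close>

lemma K_one_not_zero: "\<one>\<^bsub>K\<^esub> \<noteq> \<zero>\<^bsub>K\<^esub>"
proof
  assume "\<one>\<^bsub>K\<^esub> = \<zero>\<^bsub>K\<^esub>"
  then have "\<one> \<odot>\<^bsub>K\<^esub> \<one>\<^bsub>K\<^esub> = \<zero> \<odot>\<^bsub>K\<^esub> \<one>\<^bsub>K\<^esub>"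
    by (simp add: smult_r_null)
  then show False
    using ground_inj by (auto dest: inj_onD)
qed

text \<open>Distributivity is not at hand here; instead, the negated identity is the scalar -1 times
  the identity, and scalars can be pulled out of products.\<close>

lemma K_mult_minus_one:
  assumes "a \<in> carrier K"
  shows "a \<otimes>\<^bsub>K\<^esub> (\<ominus>\<^bsub>K\<^esub> \<one>\<^bsub>K\<^esub>) = \<ominus>\<^bsub>K\<^esub> a"
proof -
  have "(\<ominus> \<one>) \<odot>\<^bsub>K\<^esub> x = \<ominus>\<^bsub>K\<^esub> x" if "x \<in> carrier K" for x
    using that by (simp add: smult_l_minus)
  then show ?thesis
    using smult_mult(2)[of "\<ominus> \<one>" a "\<one>\<^bsub>K\<^esub>"] assms by (simp add: conj_alg_simps)
qed

end

text \<open>Conjugation is additive and fixes the identity, so the left side expands to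
  \<open>a\<close> plus the norm of \<open>a\<close>.\<close>

lemma (in distributive_conj_algebra) conj_one_plus_mult:
  assumes "a \<in> carrier K" "conjugate K a \<otimes>\<^bsub>K\<^esub> a = \<one>\<^bsub>K\<^esub>"
  shows "conjugate K (\<one>\<^bsub>K\<^esub> \<oplus>\<^bsub>K\<^esub> a) \<otimes>\<^bsub>K\<^esub> a = \<one>\<^bsub>K\<^esub> \<oplus>\<^bsub>K\<^esub> a"
  using assms by (simp add: conj_alg_simps K_l_distr M.a_comm)

text \<open>Conjugation in a double negates the second coordinate, so a pair with first coordinate
  zero is skew. This covers every characteristic.\<close>

lemma cd_double_skew_element:
  fixes R (structure) and K :: "('k, 'k cd) conj_algebra"
  assumes "conj_algebra R K" and "D \<in> carrier R"
  defines "L \<equiv> cd_double D K"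
  shows "\<exists>b \<in> carrier L. b \<noteq> \<zero>\<^bsub>L\<^esub> \<and> conjugate L b = \<ominus>\<^bsub>L\<^esub> b"
proof -
  interpret conj_algebra R K by fact
  interpret L: conj_algebra R L
    unfolding L_def by (rule conj_algebra_cd_double) fact+
  let ?b = "Pr \<zero>\<^bsub>K\<^esub> \<one>\<^bsub>K\<^esub>"
  have b: "?b \<in> carrier L" "conjugate L ?b \<in> carrier L"
    and "conjugate L ?b \<oplus>\<^bsub>L\<^esub> ?b = \<zero>\<^bsub>L\<^esub>" and "?b \<noteq> \<zero>\<^bsub>L\<^esub>"
    by (auto simp: L_def cd_double_def conj_alg_simps M.l_neg K_one_not_zero)
  \<comment> \<open>Negation in \<open>L\<close> is not defined by coordinates, so it is identified
    through uniqueness of additive inverses.\<close>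
  moreover from this have "conjugate L ?b = \<ominus>\<^bsub>L\<^esub> ?b"
    using L.M.minus_equality by metis
  ultimately show ?thesis by blast
qed

theorem corollary1:
  fixes k :: "('k, 'r) ring_scheme" and D :: "nat \<Rightarrow> 'k" and i :: nat and a :: "'k cd"
  assumes "field k"
    and "\<And>j. 1 \<le> j \<Longrightarrow> D j \<in> carrier k"
    and "1 \<le> i"
    and "a \<in> carrier (cd_tower k D i)"
    and "cd_norm (cd_tower k D i) a = \<one>\<^bsub>cd_tower k D i\<^esub>"
  shows "\<exists>b \<in> carrier (cd_tower k D i). b \<noteq> \<zero>\<^bsub>cd_tower k D i\<^esub> \<and>
           conjugate (cd_tower k D i) b \<otimes>\<^bsub>cd_tower k D i\<^esub> a = b"
proof -
  let ?L = "cd_tower k D i"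
  interpret L: distributive_conj_algebra k ?L
    using assms(1,2) by (rule distributive_cd_tower)
  show ?thesis
  \<comment> \<open>The witness 1 + a satisfies the equation in any case; only its being nonzero can
    fail.\<close>
  proof (cases "\<one>\<^bsub>?L\<^esub> \<oplus>\<^bsub>?L\<^esub> a = \<zero>\<^bsub>?L\<^esub>")
    case False
    with assms(4,5) show ?thesis
      by (intro bexI[of _ "\<one>\<^bsub>?L\<^esub> \<oplus>\<^bsub>?L\<^esub> a"])
        (simp_all add: cd_norm_def L.conj_one_plus_mult L.K_one_closed)
  next
    case True
    then have a: "a = \<ominus>\<^bsub>?L\<^esub> \<one>\<^bsub>?L\<^esub>"
      using L.M.minus_equality[of a "\<one>\<^bsub>?L\<^esub>"] assms(4)
      by (simp add: L.M.a_comm L.K_one_closed)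
    \<comment> \<open>Here \<open>1 \<le> i\<close> is essential: on \<open>k\<close> itself
      conjugation is the identity, and a = -1 would force 2b = 0.\<close>
    obtain j where i: "i = Suc j"
      using assms(3) by (cases i) auto
    have "conj_algebra k (cd_tower k D j)"
      using assms(1,2) by (rule conj_algebra_cd_tower)
    then obtain b where b: "b \<in> carrier ?L" "b \<noteq> \<zero>\<^bsub>?L\<^esub>" "conjugate ?L b = \<ominus>\<^bsub>?L\<^esub> b"
      using cd_double_skew_element[of k "cd_tower k D j" "D i"] assms(2,3) by (auto simp: i)
    \<comment> \<open>The two signs cancel: (-b)(-1) = b.\<close>
    then have "conjugate ?L b \<otimes>\<^bsub>?L\<^esub> a = b"
      by (simp add: a L.K_mult_minus_one)
    with b show ?thesis by blast
  qed
qed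

end
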